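(* Let $N\in\mathbb N$ and fix a vertex $\varkappa$ of $H(N,2)$, with subconstituent algebra $T=T(\varkappa)$. The Hermitian forms on $P_N$ and $T$ are related by $$\langle f,g\rangle=\langle\vartheta(f),\vartheta(g)\rangle\qquad\text{for all } f,g\in P_N .$$
   Context: $\mathbb N=\{0,1,2,\ldots\}$; all vector spaces are over $\mathbb C$; Hermitian forms are linear in the first argument and conjugate-symmetric. $P=\mathbb C[x,y,z,w]$, $P_N$ is the subspace of homogeneous polynomials of total degree $N$, $\mathcal P_N$ is the set of $(r,s,t,u)\in\mathbb N^4$ with $r+s+t+u=N$. $P$ carries the Hermitian form for which the monomials $x^ry^sz^tw^u$ are mutually orthogonal with $\langle x^ry^sz^tw^u,x^ry^sz^tw^u\rangle=r!s!t!u!$. $H(N,2)$ is the graph with vertex set $X=\{1,-1\}^N$, two vertices adjacent when they differ in exactly one coordinate; $\partial$ is path-length distance. $V$ is the vector space with basis $X$; $V^{\otimes3}$ has basis $X^{\otimes 3}=\{x\otimes y\otimes z:x,y,z\in X\}$. $G$ is the automorphism group of the graph, acting linearly on $V$ by permuting $X$ and diagonally on $V^{\otimes 3}$; ${\rm Fix}(G)=\{v\in V^{\otimes3}:g(v)=v\ \forall g\in G\}$. The adjacency map ${\sf A}\in{\rm End}(V)$ sends each vertex to the sum of its neighbours; ${\sf A}^*\in{\rm End}(V)$ is given by ${\sf A}^*x=(N-2\partial(x,\varkappa))x$ for $x\in X$; $T$ is the subalgebra of ${\rm End}(V)$ generated by ${\sf A},{\sf A}^*$. For $x,y\in X$, $e_{x,y}\in{\rm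 End}(V)$ sends $y\mapsto x$ and all other vertices to $0$; ${\rm End}(V)$ carries the Hermitian form for which $\{e_{x,y}\}_{x,y\in X}$ is orthonormal, and $T$ has the restricted form. The profile of $x\otimes y\otimes z\in X^{\otimes 3}$ is $(r,s,t,u)\in\mathcal P_N$, where $r=|\{i:x_i=y_i=z_i\}|$, $s=|\{i:x_i\ne y_i=z_i\}|$, $t=|\{i:y_i\neq z_i=x_i\}|$, $u=|\{i:z_i\ne x_i=y_i\}|$. $B(r,s,t,u)$ is the sum of all elements of $X^{\otimes3}$ with profile $(r,s,t,u)$ and $\tilde B(r,s,t,u)=\frac{r!s!t!u!}{N!\,2^N}B(r,s,t,u)$; these form a basis of ${\rm Fix}(G)$. The linear isomorphism $\ddag:P_N\to{\rm Fix}(G)$ sends $x^ry^sz^tw^u\mapsto(N!\,2^N)^{1/2}\tilde B(r,s,t,u)$. The linear map $\varepsilon:V^{\otimes 3}\to{\rm End}(V)$ is given by $\varepsilon(x\otimes y\otimes z)=2^{N/2}e_{y,z}$ if $x=\varkappa$ and $0$ if $x\ne\varkappa$ $(x,y,z\in X)$; it maps ${\rm Fix}(G)$ bijectively onto $T$. The map $\vartheta:P_N\to T$ is $f\mapsto\varepsilon(f^\ddag)$. *)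

theory Defs
  imports Complex_Main "HOL-Library.Poly_Mapping" "HOL-Library.Product_Plus" "HOL-Library.FuncSet"
begin

section \<open>Free complex vector spaces\<close>

text \<open>The complex vector space with basis \<open>'a\<close> is the type \<open>'a \<Rightarrow>\<^sub>0 complex\<close>,
  with basis vectors \<open>basis a\<close>. Its subspace spanned by a set \<open>S\<close> of basis vectors consists of
  the \<open>v\<close> with \<open>Poly_Mapping.keys v \<subseteq> S\<close>.\<close>

abbreviation basis :: "'a \<Rightarrow> 'a \<Rightarrow>\<^sub>0 complex" where
  "basis a \<equiv> Poly_Mapping.single a 1"

definition scale :: "complex \<Rightarrow> ('a \<Rightarrow>\<^sub>0 complex) \<Rightarrow> 'a \<Rightarrow>\<^sub>0 complex" (infixr \<open>\<cdot>\<close> 75) where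
  "c \<cdot> v = Poly_Mapping.map ((*) c) v"

text \<open>The linear extension of a map given on basis vectors.\<close>

definition lin_ext :: "('a \<Rightarrow> 'b \<Rightarrow>\<^sub>0 complex) \<Rightarrow> ('a \<Rightarrow>\<^sub>0 complex) \<Rightarrow> 'b \<Rightarrow>\<^sub>0 complex" where
  "lin_ext \<phi> v = (\<Sum>a\<in>Poly_Mapping.keys v. Poly_Mapping.lookup v a \<cdot> \<phi> a)"

lemma lookup_scale [simp]: "Poly_Mapping.lookup (c \<cdot> v) a = c * Poly_Mapping.lookup v a"
  by (simp add: scale_def Poly_Mapping.map.rep_eq when_def)

lemma scale_one [simp]: "1 \<cdot> v = v"
  by (rule poly_mapping_eqI) simp

lemma scale_zero [simp]: "0 \<cdot> v = 0" "c \<cdot> 0 = (0 :: 'a \<Rightarrow>\<^sub>0 complex)"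
  by (rule poly_mapping_eqI, simp)+

lemma keys_scale: "Poly_Mapping.keys (c \<cdot> v) \<subseteq> Poly_Mapping.keys v"
  by (auto simp: in_keys_iff)

lemma lookup_lin_ext:
  assumes "finite A" "Poly_Mapping.keys v \<subseteq> A"
  shows "Poly_Mapping.lookup (lin_ext \<phi> v) b = (\<Sum>a\<in>A. Poly_Mapping.lookup v a * Poly_Mapping.lookup (\<phi> a) b)"
  unfolding lin_ext_def lookup_sum lookup_scale
  by (rule sum.mono_neutral_left) (use assms in \<open>auto simp: in_keys_iff\<close>)

lemma lin_ext_basis [simp]: "lin_ext \<phi> (basis a) = \<phi> a"
  by (simp add: lin_ext_def)

lemma lin_ext_add: "lin_ext \<phi> (u + v) = lin_ext \<phi> u + lin_ext \<phi> v"
proof (rule poly_mapping_eqI)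
  fix b
  let ?A = "Poly_Mapping.keys u \<union> Poly_Mapping.keys v"
  have "Poly_Mapping.keys (u + v) \<subseteq> ?A" by (rule keys_add)
  then show "Poly_Mapping.lookup (lin_ext \<phi> (u + v)) b = Poly_Mapping.lookup (lin_ext \<phi> u + lin_ext \<phi> v) b"
    by (simp add: lookup_lin_ext[of ?A] lookup_add distrib_right sum.distrib)
qed

lemma lin_ext_scale: "lin_ext \<phi> (c \<cdot> v) = c \<cdot> lin_ext \<phi> v"
  by (rule poly_mapping_eqI)
     (simp add: lookup_lin_ext[of "Poly_Mapping.keys v"] keys_scale sum_distrib_left mult.assoc)

lemma keys_lin_ext:
  assumes "\<And>a. a \<in> Poly_Mapping.keys v \<Longrightarrow> Poly_Mapping.keys (\<phi> a) \<subseteq> B"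
  shows "Poly_Mapping.keys (lin_ext \<phi> v) \<subseteq> B"
proof
  fix b assume "b \<in> Poly_Mapping.keys (lin_ext \<phi> v)"
  then have "(\<Sum>a\<in>Poly_Mapping.keys v. Poly_Mapping.lookup v a * Poly_Mapping.lookup (\<phi> a) b) \<noteq> 0"
    by (simp add: in_keys_iff lookup_lin_ext[of "Poly_Mapping.keys v"])
  then obtain a where "a \<in> Poly_Mapping.keys v" "Poly_Mapping.lookup (\<phi> a) b \<noteq> 0"
    by (metis (no_types, lifting) mult_zero_right sum.neutral)
  with assms[of a] show "b \<in> B" by (auto simp: in_keys_iff)
qed

section \<open>The polynomial algebra\<close>

text \<open>\<open>\<complex>[x,y,z,w]\<close> is the monoid algebra of \<open>\<nat>\<^sup>4\<close>; the exponent \<open>(r,s,t,u)\<close> stands for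
  the monomial \<open>x\<^sup>r y\<^sup>s z\<^sup>t w\<^sup>u\<close>.\<close>

type_synonym expo = "nat \<times> nat \<times> nat \<times> nat"
type_synonym poly4 = "expo \<Rightarrow>\<^sub>0 complex"

definition expos :: "nat \<Rightarrow> expo set" where
  "expos N = {(r, s, t, u). r + s + t + u = N}"

definition P :: "nat \<Rightarrow> poly4 set" where
  "P N = {f. Poly_Mapping.keys f \<subseteq> expos N}"

definition expo_fact :: "expo \<Rightarrow> nat" where
  "expo_fact = (\<lambda>(r, s, t, u). fact r * fact s * fact t * fact u)"

definition P_form :: "poly4 \<Rightarrow> poly4 \<Rightarrow> complex" where
  "P_form f g = (\<Sum>m\<in>Poly_Mapping.keys f. Poly_Mapping.lookup f m * cnj (Poly_Mapping.lookup g m) * of_nat (expo_fact m))"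

lemma monomial_eq:
  "(basis (1, 0, 0, 0) :: poly4) ^ r * basis (0, 1, 0, 0) ^ s * basis (0, 0, 1, 0) ^ t
     * basis (0, 0, 0, 1) ^ u = basis (r, s, t, u)"
proof -
  have pow: "basis (1, 0, 0, 0) ^ n = (basis (n, 0, 0, 0) :: poly4)"
    "basis (0, 1, 0, 0) ^ n = (basis (0, n, 0, 0) :: poly4)"
    "basis (0, 0, 1, 0) ^ n = (basis (0, 0, n, 0) :: poly4)"
    "basis (0, 0, 0, 1) ^ n = (basis (0, 0, 0, n) :: poly4)" for n
    by (induction n) (simp_all add: mult_single flip: zero_prod_def)
  show ?thesis unfolding pow by (simp add: mult_single)
qed

lemma P_form_monomial:
  "P_form (basis m) (basis m') = (if m = m' then of_nat (expo_fact m) else 0)"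
  by (simp add: P_form_def lookup_single when_def)

section \<open>The hypercube\<close>

type_synonym vertex = "nat \<Rightarrow> int"

definition X :: "nat \<Rightarrow> vertex set" where
  "X N = {1..N} \<rightarrow>\<^sub>E {1, -1}"

definition edges :: "nat \<Rightarrow> (vertex \<times> vertex) set" where
  "edges N = {(x, y). x \<in> X N \<and> y \<in> X N \<and> card {i \<in> {1..N}. x i \<noteq> y i} = 1}"

text \<open>Path-length distance: the least length of a walk from \<open>x\<close> to \<open>y\<close>.\<close>

definition distance :: "nat \<Rightarrow> vertex \<Rightarrow> vertex \<Rightarrow> nat" where
  "distance N x y = (LEAST n. (x, y) \<in> edges N ^^ n)"

definition profile :: "nat \<Rightarrow> vertex \<Rightarrow> vertex \<Rightarrow> vertex \<Rightarrow> expo" where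
  "profile N x y z =
    (card {i \<in> {1..N}. x i = y i \<and> y i = z i},
     card {i \<in> {1..N}. x i \<noteq> y i \<and> y i = z i},
     card {i \<in> {1..N}. y i \<noteq> z i \<and> z i = x i},
     card {i \<in> {1..N}. z i \<noteq> x i \<and> x i = y i})"

lemma finite_X [simp]: "finite (X N)"
  by (simp add: X_def finite_PiE)

section \<open>The standard module, its endomorphisms, and the subconstituent algebra\<close>

definition V :: "nat \<Rightarrow> (vertex \<Rightarrow>\<^sub>0 complex) set" where
  "V N = {v. Poly_Mapping.keys v \<subseteq> X N}"

text \<open>An endomorphism of \<open>V N\<close> is a function on \<open>V N\<close>, encoded as an extensional function on the
  ambient type.\<close>

type_synonym endo = "(vertex \<Rightarrow>\<^sub>0 complex) \<Rightarrow> (vertex \<Rightarrow>\<^sub>0 complex)"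

definition End :: "nat \<Rightarrow> endo set" where
  "End N = {F \<in> V N \<rightarrow>\<^sub>E V N. (\<forall>u\<in>V N. \<forall>v\<in>V N. F (u + v) = F u + F v) \<and>
                              (\<forall>c. \<forall>v\<in>V N. F (c \<cdot> v) = c \<cdot> F v)}"

definition subalgebra :: "nat \<Rightarrow> endo set \<Rightarrow> bool" where
  "subalgebra N S \<longleftrightarrow>
     S \<subseteq> End N \<and> (\<lambda>v\<in>V N. v) \<in> S \<and>
     (\<forall>c. \<forall>F\<in>S. (\<lambda>v\<in>V N. c \<cdot> F v) \<in> S) \<and>
     (\<forall>F\<in>S. \<forall>G\<in>S. (\<lambda>v\<in>V N. F v + G v) \<in> S) \<and>
     (\<forall>F\<in>S. \<forall>G\<in>S. compose (V N) F G \<in> S)"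

definition A :: "nat \<Rightarrow> endo" where
  "A N = (\<lambda>v\<in>V N. lin_ext (\<lambda>x. \<Sum>y | (x, y) \<in> edges N. basis y) v)"

definition A_star :: "nat \<Rightarrow> vertex \<Rightarrow> endo" where
  "A_star N \<kappa> = (\<lambda>v\<in>V N. lin_ext (\<lambda>x. (of_nat N - 2 * of_nat (distance N x \<kappa>)) \<cdot> basis x) v)"

definition T :: "nat \<Rightarrow> vertex \<Rightarrow> endo set" where
  "T N \<kappa> = subalgebra N hull {A N, A_star N \<kappa>}"

definition e :: "nat \<Rightarrow> vertex \<Rightarrow> vertex \<Rightarrow> endo" where
  "e N x y = (\<lambda>v\<in>V N. lin_ext (\<lambda>z. if z = y then basis x else 0) v)"

text \<open>The coefficient of \<open>e N x y\<close> in \<open>F\<close> is \<open>Poly_Mapping.lookup (F (basis y)) x\<close>.\<close>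

definition End_form :: "nat \<Rightarrow> endo \<Rightarrow> endo \<Rightarrow> complex" where
  "End_form N F G =
     (\<Sum>x\<in>X N. \<Sum>y\<in>X N. Poly_Mapping.lookup (F (basis y)) x * cnj (Poly_Mapping.lookup (G (basis y)) x))"

text \<open>Being undefined off \<open>T N \<kappa>\<close>, this form makes any equation for its values at
  \<open>\<theta> N \<kappa> f\<close> and \<open>\<theta> N \<kappa> g\<close> below depend on these elements lying in \<open>T N \<kappa>\<close>.\<close>

definition T_form :: "nat \<Rightarrow> vertex \<Rightarrow> endo \<Rightarrow> endo \<Rightarrow> complex" where
  "T_form N \<kappa> = (\<lambda>F\<in>T N \<kappa>. \<lambda>G\<in>T N \<kappa>. End_form N F G)"

lemma basis_in_V [simp]: "x \<in> X N \<Longrightarrow> basis x \<in> V N"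
  by (simp add: V_def)

lemma V_closed:
  shows V_0: "0 \<in> V N"
    and V_add: "u \<in> V N \<Longrightarrow> v \<in> V N \<Longrightarrow> u + v \<in> V N"
    and V_scale: "v \<in> V N \<Longrightarrow> c \<cdot> v \<in> V N"
  using keys_add[of u v] keys_scale[of c v] by (auto simp: V_def)

lemma lin_ext_in_End:
  assumes "\<And>x. x \<in> X N \<Longrightarrow> \<phi> x \<in> V N"
  shows "(\<lambda>v\<in>V N. lin_ext \<phi> v) \<in> End N"
proof -
  have "lin_ext \<phi> v \<in> V N" if "v \<in> V N" for v
    using that assms keys_lin_ext[of v \<phi> "X N"] by (auto simp: V_def)
  then show ?thesis
    by (auto simp: End_def V_add V_scale lin_ext_add lin_ext_scale)
qed

lemma End_apply [intro]: "F \<in> End N \<Longrightarrow> v \<in> V N \<Longrightarrow> F v \<in> V N"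
  by (auto simp: End_def)

lemma subalgebra_End: "subalgebra N (End N)"
  unfolding subalgebra_def
proof (intro conjI allI ballI)
  show "(\<lambda>v\<in>V N. v) \<in> End N"
    by (auto simp: End_def V_add V_scale)
next
  fix c F assume F: "F \<in> End N"
  have "c \<cdot> (a + b) = c \<cdot> a + c \<cdot> b" "c \<cdot> d \<cdot> a = d \<cdot> c \<cdot> a"
    for a b :: "vertex \<Rightarrow>\<^sub>0 complex" and d
    by (rule poly_mapping_eqI, simp add: lookup_add algebra_simps)+
  with F show "(\<lambda>v\<in>V N. c \<cdot> F v) \<in> End N"
    using End_apply[OF F] by (auto simp: End_def V_add V_scale)
next
  fix F G assume FG: "F \<in> End N" "G \<in> End N"
  have "c \<cdot> (a + b) = c \<cdot> a + c \<cdot> b" for a b :: "vertex \<Rightarrow>\<^sub>0 complex" and c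
    by (rule poly_mapping_eqI) (simp add: lookup_add algebra_simps)
  with FG show "(\<lambda>v\<in>V N. F v + G v) \<in> End N"
    using End_apply[OF FG(1)] End_apply[OF FG(2)]
    by (auto simp: End_def V_add V_scale algebra_simps)
next
  fix F G assume FG: "F \<in> End N" "G \<in> End N"
  then show "compose (V N) F G \<in> End N"
    using End_apply[OF FG(1)] End_apply[OF FG(2)]
    by (auto simp: End_def V_add V_scale compose_def)
qed simp

lemma A_in_End: "A N \<in> End N"
  unfolding A_def
proof (rule lin_ext_in_End)
  fix x
  have "Poly_Mapping.keys (\<Sum>y | (x, y) \<in> edges N. basis y) \<subseteq> (\<Union>y\<in>{y. (x, y) \<in> edges N}. Poly_Mapping.keys (basis y))"
    by (rule keys_sum)
  then show "(\<Sum>y | (x, y) \<in> edges N. basis y) \<in> V N"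
    by (auto simp: V_def edges_def)
qed

lemma A_star_in_End: "A_star N \<kappa> \<in> End N"
  unfolding A_star_def by (rule lin_ext_in_End) (simp add: V_scale)

lemma T_subset_End: "T N \<kappa> \<subseteq> End N"
  unfolding T_def by (rule hull_minimal) (simp_all add: subalgebra_End A_in_End A_star_in_End)

lemma e_in_End: "x \<in> X N \<Longrightarrow> e N x y \<in> End N"
  unfolding e_def by (rule lin_ext_in_End) (simp add: V_0)

lemma End_form_e:
  assumes "x \<in> X N" "y \<in> X N" "x' \<in> X N" "y' \<in> X N"
  shows "End_form N (e N x y) (e N x' y') = (if x = x' \<and> y = y' then 1 else 0)"
proof -
  have "Poly_Mapping.lookup (e N x y (basis b)) a = (if a = x then if b = y then 1 else 0 else 0)"
    if "b \<in> X N" for a b x y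
    using that by (auto simp: e_def lookup_single when_def)
  then have "End_form N (e N x y) (e N x' y') =
      (\<Sum>a\<in>X N. \<Sum>b\<in>X N. if b = y then if a = x \<and> a = x' \<and> b = y' then 1 else 0 else 0)"
    unfolding End_form_def by (intro sum.cong refl) auto
  also have "\<dots> = (\<Sum>a\<in>X N. if a = x then if x = x' \<and> y = y' then 1 else 0 else 0)"
    using assms by (intro sum.cong refl) (simp add: sum.delta)
  finally show ?thesis using assms by (simp add: sum.delta)
qed

section \<open>The map from polynomials to the subconstituent algebra\<close>

text \<open>The basis of \<open>V \<otimes> V \<otimes> V\<close> consists of triples of vertices.\<close>

type_synonym tensor = "(vertex \<times> vertex \<times> vertex) \<Rightarrow>\<^sub>0 complex"

definition B :: "nat \<Rightarrow> expo \<Rightarrow> tensor" where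
  "B N m = (\<Sum>(x, y, z) \<in> {(x, y, z) \<in> X N \<times> X N \<times> X N. profile N x y z = m}. basis (x, y, z))"

definition B_tilde :: "nat \<Rightarrow> expo \<Rightarrow> tensor" where
  "B_tilde N m = (of_nat (expo_fact m) / (fact N * 2 ^ N)) \<cdot> B N m"

definition ddag :: "nat \<Rightarrow> poly4 \<Rightarrow> tensor" where
  "ddag N = lin_ext (\<lambda>m. complex_of_real (sqrt (fact N * 2 ^ N)) \<cdot> B_tilde N m)"

text \<open>\<open>\<epsilon>_basis N \<kappa> (x, y, z)\<close> is the value of \<open>\<epsilon>\<close> at \<open>x \<otimes> y \<otimes> z\<close>.\<close>

definition \<epsilon>_basis :: "nat \<Rightarrow> vertex \<Rightarrow> vertex \<times> vertex \<times> vertex \<Rightarrow> endo" where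
  "\<epsilon>_basis N \<kappa> = (\<lambda>(x, y, z). \<lambda>v\<in>V N.
     if x = \<kappa> then complex_of_real (2 powr (real N / 2)) \<cdot> e N y z v else 0)"

definition \<epsilon> :: "nat \<Rightarrow> vertex \<Rightarrow> tensor \<Rightarrow> endo" where
  "\<epsilon> N \<kappa> \<tau> = (\<lambda>v\<in>V N. lin_ext (\<lambda>b. \<epsilon>_basis N \<kappa> b v) \<tau>)"

definition \<theta> :: "nat \<Rightarrow> vertex \<Rightarrow> poly4 \<Rightarrow> endo" where
  "\<theta> N \<kappa> f = \<epsilon> N \<kappa> (ddag N f)"

end

theory Submission
  imports Defs
begin

text \<open>Recording the coordinates in which a vertex differs from \<open>\<kappa>\<close> identifies vertices with
  subsets of \<open>{1..N}\<close>, so that matrices become kernels \<open>K Y Z\<close> and \<open>\<theta> N \<kappa> f\<close> is the kernel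
  that multiplies the coefficient of \<open>f\<close> at the profile \<open>m\<close> of \<open>(\<kappa>, y, z)\<close> by
  \<open>expo_fact m / sqrt (fact N)\<close>. As exactly \<open>fact N / expo_fact m\<close> pairs have profile \<open>m\<close>, the
  forms agree. That \<open>\<theta> N \<kappa> f\<close> lies in \<open>T N \<kappa>\<close> is seen as follows: polynomials in \<open>A_star\<close> give
  the projections onto the levels \<open>card Y = k\<close>; cutting \<open>A\<close> with them gives the covering relation,
  whose powers give \<open>Z \<subseteq> Y\<close>; then \<open>\<Sum>W. [W \<subseteq> Y] [card W = p] [W \<subseteq> Z]\<close> is
  \<open>card (Y \<inter> Z) choose p\<close>, and these determine \<open>card (Y \<inter> Z)\<close>.\<close>

section \<open>Kernels on the subsets of a finite set\<close>

text \<open>The counterpart of T for kernels. \<open>adj\<close> plays the adjacency map;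
  \<open>card\<close> stands in for the dual adjacency map, which is \<open>N - 2 * card Y\<close>
  on the diagonal. Rule \<open>cong\<close> makes values away from the subsets of \<open>I\<close>
  irrelevant, as products sum over \<open>Pow I\<close> only.\<close>

inductive_set kalg :: "'a set \<Rightarrow> ('a set \<Rightarrow> 'a set \<Rightarrow> complex) set" for I :: "'a set" where
  one: "(\<lambda>Y Z. of_bool (Y = Z)) \<in> kalg I"
| adj: "(\<lambda>Y Z. of_bool (card (sym_diff Y Z) = 1)) \<in> kalg I"
| card: "(\<lambda>Y Z. of_bool (Y = Z) * of_nat (card Y)) \<in> kalg I"
| scale: "K \<in> kalg I \<Longrightarrow> (\<lambda>Y Z. c * K Y Z) \<in> kalg I"
| add: "K \<in> kalg I \<Longrightarrow> L \<in> kalg I \<Longrightarrow> (\<lambda>Y Z. K Y Z + L Y Z) \<in> kalg I"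
| mult: "K \<in> kalg I \<Longrightarrow> L \<in> kalg I \<Longrightarrow> (\<lambda>Y Z. \<Sum>W\<in>Pow I. K Y W * L W Z) \<in> kalg I"
| cong: "K \<in> kalg I \<Longrightarrow> (\<And>Y Z. Y \<subseteq> I \<Longrightarrow> Z \<subseteq> I \<Longrightarrow> K Y Z = L Y Z) \<Longrightarrow> L \<in> kalg I"

lemma kalg_zero: "(\<lambda>Y Z. 0) \<in> kalg I"
  using kalg.scale[OF kalg.one, of 0 I] by simp

lemma kalg_sum:
  assumes "\<And>j. j \<in> J \<Longrightarrow> K j \<in> kalg I"
  shows "(\<lambda>Y Z. \<Sum>j\<in>J. K j Y Z) \<in> kalg I"
  using assms by (induction J rule: infinite_finite_induct) (auto intro: kalg_zero kalg.add)

lemma kalg_diff: "K \<in> kalg I \<Longrightarrow> L \<in> kalg I \<Longrightarrow> (\<lambda>Y Z. K Y Z - L Y Z) \<in> kalg I"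
  using kalg.add[OF _ kalg.scale[of L I "-1"], of K] by simp

text \<open>The three generators are symmetric, and transposing a product reverses its factors. This
  turns row operations into column operations.\<close>

lemma kalg_transpose: "K \<in> kalg I \<Longrightarrow> (\<lambda>Y Z. K Z Y) \<in> kalg I"
proof (induction rule: kalg.induct)
  case one
  show ?case using kalg.one[of I] by (simp add: eq_commute)
next
  case adj
  show ?case using kalg.adj[of I] by (simp add: Un_commute)
next
  case card
  show ?case by (rule kalg.cong[OF kalg.card]) auto
next
  case (mult K L)
  from kalg.mult[OF mult.IH(2) mult.IH(1)] show ?case by (simp add: mult.commute)
next
  case (cong K L)
  then show ?case by (intro kalg.cong[OF cong.IH(1)]) auto
qed (auto intro: kalg.intros)

section \<open>Diagonal kernels and level projections\<close>

lemma kalg_diag_mult: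
  assumes "finite I" "(\<lambda>Y Z. of_bool (Y = Z) * f Y) \<in> kalg I" "K \<in> kalg I"
  shows "(\<lambda>Y Z. f Y * K Y Z) \<in> kalg I"
\<comment> \<open>Left multiplication by a diagonal kernel rescales the rows.\<close>
proof (rule kalg.cong[OF kalg.mult[OF assms(2,3)]])
  fix Y Z assume "Y \<subseteq> I"
  then show "(\<Sum>W\<in>Pow I. of_bool (Y = W) * f Y * K W Z) = f Y * K Y Z"
    using assms(1) sum.delta[of "Pow I" Y "\<lambda>W. f Y * K Y Z"]
    by (subst sum.cong[of _ _ _ "\<lambda>W. if W = Y then f Y * K Y Z else 0"]) auto
qed

text \<open>Lagrange interpolation in the diagonal kernel \<open>card\<close>: the polynomial is 1
  at \<open>k\<close> and 0 at every other size that occurs.\<close>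

lemma kalg_diag_of_bool:
  assumes "finite I"
  shows "(\<lambda>Y Z. of_bool (Y = Z) * of_bool (card Y = k)) \<in> kalg I"
proof -
  have interp: "(\<lambda>Y Z. of_bool (Y = Z) * (\<Prod>j\<in>J. (of_nat (card Y) - of_nat j) / (of_nat k - of_nat j)))
      \<in> kalg I" if "finite J" for J
    using that
  proof (induction J)
    case empty
    show ?case using kalg.one[of I] by simp
  next
    case (insert l J)
    have "(\<lambda>Y Z. 1 / (of_nat k - of_nat l) * (of_bool (Y = Z) * of_nat (card Y) - of_nat l * of_bool (Y = Z))) \<in> kalg I"
      by (intro kalg.scale kalg_diff kalg.one kalg.card)
    then have "(\<lambda>Y Z. of_bool (Y = Z) * ((of_nat (card Y) - of_nat l) / (of_nat k - of_nat l))) \<in> kalg I"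
      by (rule kalg.cong) auto
    from kalg_diag_mult[OF assms this insert.IH] insert.hyps show ?case
      by (simp add: mult.left_commute mult.assoc)
  qed
  show ?thesis
  \<comment> \<open>The nodes are all sizes of subsets of \<open>I\<close> except \<open>k\<close>.
    If \<open>k > card I\<close>, then \<open>card Y\<close> is always a node and the product
    vanishes, as it should.\<close>
  proof (rule kalg.cong[OF interp[of "{..card I} - {k}"]])
    fix Y Z assume "Y \<subseteq> I"
    then have "card Y \<le> card I" using assms by (simp add: card_mono)
    then show "of_bool (Y = Z) * (\<Prod>j\<in>{..card I} - {k}. (of_nat (card Y) - of_nat j) / (of_nat k - of_nat j))
        = (of_bool (Y = Z) * of_bool (card Y = k) :: complex)"
      by (cases "card Y = k") auto
  qed simp
qed

lemma kalg_restrict: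
  assumes "finite I" "K \<in> kalg I"
  shows "(\<lambda>Y Z. of_bool (card Y = j \<and> card Z = k) * K Y Z) \<in> kalg I"
proof -
  have row: "(\<lambda>Y Z. of_bool (card Y = i) * L Y Z) \<in> kalg I" if "L \<in> kalg I" for i L
    by (rule kalg_diag_mult[OF assms(1) kalg_diag_of_bool[OF assms(1)] that])
  have "(\<lambda>Y Z. of_bool (card Y = j) * (of_bool (card Z = k) * K Y Z)) \<in> kalg I"
    \<comment> \<open>Transpose, cut the rows to level \<open>k\<close>, transpose back, cut the
      rows to level \<open>j\<close>.\<close>
    using row[OF kalg_transpose[OF row[OF kalg_transpose[OF assms(2)]]]] .
  then show ?thesis by (rule kalg.cong) auto
qed

section \<open>The inclusion relation\<close>

lemma card_sym_diff_eq_1_iff: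
  assumes "finite Y" "finite Z" "card Y = Suc (card Z)"
  shows "card (sym_diff Y Z) = 1 \<longleftrightarrow> Z \<subseteq> Y"
proof -
  have 1: "card (sym_diff Y Z) = card (Y - Z) + card (Z - Y)"
    using assms by (intro card_Un_disjoint) auto
  have 2: "card Y = card (Y - Z) + card (Y \<inter> Z)" "card Z = card (Z - Y) + card (Y \<inter> Z)"
    using card_Int_Diff[OF assms(1), of Z] card_Int_Diff[OF assms(2), of Y]
    by (simp_all only: Int_commute[of Z Y] add.commute)
  \<comment> \<open>Since \<open>card (Y - Z)\<close> is \<open>card (Z - Y) + 1\<close>, the
    symmetric difference has \<open>2 * card (Z - Y) + 1\<close> elements.\<close>
  have "card (sym_diff Y Z) = 1 \<longleftrightarrow> card (Z - Y) = 0"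
    using 1 2 assms(3) by linarith
  then show ?thesis using assms(2) by auto
qed

text \<open>Adjacent sets lie on neighbouring levels. Keeping only the blocks with row level
  \<open>Suc k\<close> and column level \<open>k\<close> leaves the half of the relation in which
  \<open>Y\<close> is the larger set.\<close>

lemma kalg_cover:
  assumes "finite I"
  shows "(\<lambda>Y Z. of_bool (Z \<subseteq> Y \<and> card Y = Suc (card Z))) \<in> kalg I"
proof (rule kalg.cong)
  show "(\<lambda>Y Z. \<Sum>k\<le>card I. of_bool (card Y = Suc k \<and> card Z = k) * of_bool (card (sym_diff Y Z) = 1)) \<in> kalg I"
    by (intro kalg_sum kalg_restrict assms kalg.adj)
next
  fix Y Z assume YZ: "Y \<subseteq> I" "Z \<subseteq> I"
  then have fin: "finite Y" "finite Z" "card Z \<le> card I"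
    using assms by (auto intro: finite_subset card_mono)
  have "(\<Sum>k\<le>card I. of_bool (card Y = Suc k \<and> card Z = k) * of_bool (card (sym_diff Y Z) = 1))
      = (\<Sum>k\<le>card I. if card Z = k then of_bool (card Y = Suc (card Z) \<and> card (sym_diff Y Z) = 1) else (0::complex))"
    by (intro sum.cong) auto
  also have "\<dots> = of_bool (card Y = Suc (card Z) \<and> card (sym_diff Y Z) = 1)"
    using fin by (simp add: sum.delta)
  also have "\<dots> = of_bool (Z \<subseteq> Y \<and> card Y = Suc (card Z))"
    using card_sym_diff_eq_1_iff[OF fin(1,2)] by (intro arg_cong[of _ _ of_bool]) blast
  finally show "(\<Sum>k\<le>card I. of_bool (card Y = Suc k \<and> card Z = k) * of_bool (card (sym_diff Y Z) = 1))
      = (of_bool (Z \<subseteq> Y \<and> card Y = Suc (card Z)) :: complex)" .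
qed

text \<open>Each such \<open>W\<close> is \<open>Y\<close> with one point of \<open>Y - Z\<close>
  removed, hence the value \<open>Suc a\<close>. It is the multiplicity divided out in
  \<open>kalg_superset_card\<close>.\<close>

lemma card_intermediate:
  assumes "finite Y"
  shows "card {W. W \<subseteq> Y \<and> card Y = Suc (card W) \<and> Z \<subseteq> W \<and> card W = card Z + a}
    = (if Z \<subseteq> Y \<and> card Y = card Z + Suc a then Suc a else 0)"
proof (cases "Z \<subseteq> Y \<and> card Y = card Z + Suc a")
  case True
  have "{W. W \<subseteq> Y \<and> card Y = Suc (card W) \<and> Z \<subseteq> W \<and> card W = card Z + a} = (\<lambda>i. Y - {i}) ` (Y - Z)"
  proof (intro equalityI subsetI)
    fix W assume W: "W \<in> {W. W \<subseteq> Y \<and> card Y = Suc (card W) \<and> Z \<subseteq> W \<and> card W = card Z + a}"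
    then have "card (Y - W) = 1"
      using assms finite_subset[of W Y] by (simp add: card_Diff_subset)
    then obtain i where "Y - W = {i}" by (auto simp: card_1_singleton_iff)
    then have "i \<in> Y - Z" "W = Y - {i}" using W by auto
    then show "W \<in> (\<lambda>i. Y - {i}) ` (Y - Z)" by blast
  next
    fix W assume "W \<in> (\<lambda>i. Y - {i}) ` (Y - Z)"
    then show "W \<in> {W. W \<subseteq> Y \<and> card Y = Suc (card W) \<and> Z \<subseteq> W \<and> card W = card Z + a}"
      using True by auto
  qed
  moreover have "inj_on (\<lambda>i. Y - {i}) (Y - Z)"
    by (auto simp: inj_on_def)
  ultimately show ?thesis
    using True assms finite_subset[of Z Y] by (simp add: card_image card_Diff_subset)
next
  case False
  then have "{W. W \<subseteq> Y \<and> card Y = Suc (card W) \<and> Z \<subseteq> W \<and> card W = card Z + a} = {}"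
    by auto
  with False show ?thesis by (simp only: card.empty if_False)
qed

lemma sum_of_bool_mult:
  assumes "finite J"
  shows "(\<Sum>W\<in>J. of_bool (p W) * of_bool (q W) :: complex) = of_nat (card {W \<in> J. p W \<and> q W})"
proof -
  have "(\<Sum>W\<in>J. of_bool (p W) * of_bool (q W) :: complex) = (\<Sum>W\<in>J. if p W \<and> q W then 1 else 0)"
    by (intro sum.cong) auto
  then show ?thesis using assms by (simp add: sum.If_cases Int_def)
qed

text \<open>Induction on the gap: composing the covering relation with gap \<open>a\<close> reaches
  every pair of gap \<open>Suc a\<close> through exactly \<open>Suc a\<close> intermediate
  sets.\<close>

lemma kalg_superset_card:
  assumes "finite I"
  shows "(\<lambda>Y Z. of_bool (Z \<subseteq> Y \<and> card Y = card Z + a)) \<in> kalg I"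
proof (induction a)
  case 0
  have "Y = Z \<longleftrightarrow> Z \<subseteq> Y \<and> card Y = card Z" if "Y \<subseteq> I" for Y Z
    using that assms card_subset_eq[of Y Z] finite_subset[of Y I] by auto
  then show ?case by (intro kalg.cong[OF kalg.one]) simp
next
  case (Suc a)
  show ?case
  proof (rule kalg.cong[OF kalg.scale[OF kalg.mult[OF kalg_cover[OF assms] Suc], of "1 / of_nat (Suc a)"]])
    fix Y Z assume YZ: "Y \<subseteq> I" "Z \<subseteq> I"
    have "{W \<in> Pow I. (W \<subseteq> Y \<and> card Y = Suc (card W)) \<and> Z \<subseteq> W \<and> card W = card Z + a}
        = {W. W \<subseteq> Y \<and> card Y = Suc (card W) \<and> Z \<subseteq> W \<and> card W = card Z + a}"
      using YZ by auto
    then show "1 / of_nat (Suc a) * (\<Sum>W\<in>Pow I. of_bool (W \<subseteq> Y \<and> card Y = Suc (card W)) *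
          of_bool (Z \<subseteq> W \<and> card W = card Z + a)) = (of_bool (Z \<subseteq> Y \<and> card Y = card Z + Suc a) :: complex)"
      using assms YZ finite_subset[of Y I]
      by (subst sum_of_bool_mult) (simp_all add: card_intermediate del: of_nat_Suc)
  qed
qed

lemma kalg_superset:
  assumes "finite I"
  shows "(\<lambda>Y Z. of_bool (Z \<subseteq> Y)) \<in> kalg I"
proof (rule kalg.cong)
  show "(\<lambda>Y Z. \<Sum>a\<le>card I. of_bool (Z \<subseteq> Y \<and> card Y = card Z + a)) \<in> kalg I"
    by (intro kalg_sum kalg_superset_card assms)
next
  fix Y Z assume "Y \<subseteq> I" "Z \<subseteq> I"
  then have fin: "finite Y" "card Y \<le> card I"
    using assms by (auto intro: finite_subset card_mono)
  then have "card Y - card Z \<le> card I" by linarith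
  \<comment> \<open>At most one gap contributes. Without \<open>Z \<subseteq> Y\<close> all terms
    vanish, whatever the truncated difference is.\<close>
  have "(\<Sum>a\<le>card I. of_bool (Z \<subseteq> Y \<and> card Y = card Z + a) :: complex)
      = (\<Sum>a\<le>card I. if a = card Y - card Z then of_bool (Z \<subseteq> Y) else 0)"
    using fin(1) card_mono[of Y Z] by (intro sum.cong) auto
  then show "(\<Sum>a\<le>card I. of_bool (Z \<subseteq> Y \<and> card Y = card Z + a)) = (of_bool (Z \<subseteq> Y) :: complex)"
    using \<open>card Y - card Z \<le> card I\<close> by (simp add: sum.delta)
qed

section \<open>Intersection sizes\<close>

lemma kalg_binomial:
  assumes "finite I"
  shows "(\<lambda>Y Z. of_nat (card (Y \<inter> Z) choose p)) \<in> kalg I"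
proof (rule kalg.cong)
  \<comment> \<open>The product of inclusion, projection onto level \<open>p\<close> and transposed
    inclusion counts the \<open>p\<close>-element sets below both \<open>Y\<close> and
    \<open>Z\<close>.\<close>
  show "(\<lambda>Y Z. \<Sum>W\<in>Pow I. of_bool (W \<subseteq> Y) * (of_bool (card W = p) * of_bool (W \<subseteq> Z))) \<in> kalg I"
    using kalg.mult[OF kalg_superset[OF assms] kalg_diag_mult[OF assms kalg_diag_of_bool[OF assms]
          kalg_transpose[OF kalg_superset[OF assms]]]] .
next
  fix Y Z assume YZ: "Y \<subseteq> I" "Z \<subseteq> I"
  have "(\<Sum>W\<in>Pow I. of_bool (W \<subseteq> Y) * (of_bool (card W = p) * of_bool (W \<subseteq> Z)) :: complex)
      = (\<Sum>W\<in>Pow I. of_bool (W \<subseteq> Y) * of_bool (card W = p \<and> W \<subseteq> Z))"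
    by (intro sum.cong) auto
  also have "\<dots> = of_nat (card {W \<in> Pow I. W \<subseteq> Y \<and> card W = p \<and> W \<subseteq> Z})"
    using assms by (intro sum_of_bool_mult) simp
  also have "{W \<in> Pow I. W \<subseteq> Y \<and> card W = p \<and> W \<subseteq> Z} = {W. W \<subseteq> Y \<inter> Z \<and> card W = p}"
    using YZ by auto
  also have "card \<dots> = card (Y \<inter> Z) choose p"
    using YZ assms by (intro n_subsets) (auto intro: finite_subset)
  finally show "(\<Sum>W\<in>Pow I. of_bool (W \<subseteq> Y) * (of_bool (card W = p) * of_bool (W \<subseteq> Z)))
      = (of_nat (card (Y \<inter> Z) choose p) :: complex)" .
qed

text \<open>The kernels \<open>card (Y \<inter> Z) choose p\<close> are unitriangular combinations of the
  indicators of \<open>card (Y \<inter> Z) = q\<close>, \<open>q \<ge> p\<close>, and are inverted by descending induction.\<close>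

lemma kalg_Int_card:
  assumes "finite I"
  shows "(\<lambda>Y Z. of_bool (card (Y \<inter> Z) = p)) \<in> kalg I"
proof (induction "card I - p" arbitrary: p rule: less_induct)
  case less
  show ?case
  proof (cases "p \<le> card I")
    case False
    have "card (Y \<inter> Z) \<noteq> p" if "Y \<subseteq> I" for Y Z
    proof -
      have "card (Y \<inter> Z) \<le> card I" using that assms by (intro card_mono) auto
      with False show ?thesis by linarith
    qed
    then show ?thesis by (intro kalg.cong[OF kalg_zero]) simp
  next
    case True
    show ?thesis
    proof (rule kalg.cong)
      show "(\<lambda>Y Z. of_nat (card (Y \<inter> Z) choose p)
          - (\<Sum>q\<in>{p<..card I}. of_nat (q choose p) * of_bool (card (Y \<inter> Z) = q))) \<in> kalg I"
        using True by (intro kalg_diff kalg_binomial kalg_sum kalg.scale less assms) auto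
    next
      fix Y Z assume "Y \<subseteq> I" "Z \<subseteq> I"
      then have le: "card (Y \<inter> Z) \<le> card I" using assms by (intro card_mono) auto
      have "(\<Sum>q\<in>{p<..card I}. of_nat (q choose p) * of_bool (card (Y \<inter> Z) = q))
          = (\<Sum>q\<in>{p<..card I}. if card (Y \<inter> Z) = q then of_nat (q choose p) else (0::complex))"
        by (intro sum.cong) auto
      also have "\<dots> = (if p < card (Y \<inter> Z) then of_nat (card (Y \<inter> Z) choose p) else 0)"
        using le by (simp add: sum.delta)
      \<comment> \<open>After the subtraction nothing is left for sizes above \<open>p\<close>. At
        size \<open>p\<close> the binomial is 1, and below \<open>p\<close> it is 0.\<close>
      finally show "of_nat (card (Y \<inter> Z) choose p)
          - (\<Sum>q\<in>{p<..card I}. of_nat (q choose p) * of_bool (card (Y \<inter> Z) = q))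
          = (of_bool (card (Y \<inter> Z) = p) :: complex)"
        by (auto simp: not_less le_less)
    qed
  qed
qed

text \<open>All three sizes are at most \<open>card I\<close>, so \<open>h\<close> is a finite
  combination of indicators of a triple of sizes, and each of these is an intersection-size kernel
  cut to two levels.\<close>

lemma kalg_card_fun:
  assumes "finite I"
  shows "(\<lambda>Y Z. h (card Y) (card (Y \<inter> Z)) (card Z)) \<in> kalg I"
proof (rule kalg.cong)
  show "(\<lambda>Y Z. \<Sum>j\<le>card I. \<Sum>k\<le>card I. \<Sum>p\<le>card I. h j p k *
      (of_bool (card Y = j \<and> card Z = k) * of_bool (card (Y \<inter> Z) = p))) \<in> kalg I"
    by (intro kalg_sum kalg.scale kalg_restrict kalg_Int_card assms)
next
  fix Y Z assume "Y \<subseteq> I" "Z \<subseteq> I"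
  then have le: "card Y \<le> card I" "card (Y \<inter> Z) \<le> card I" "card Z \<le> card I"
    using assms by (auto intro: card_mono)
  have "(\<Sum>p\<le>card I. h j p k * (of_bool (card Y = j \<and> card Z = k) * of_bool (card (Y \<inter> Z) = p)))
      = (if card Z = k then if card Y = j then h (card Y) (card (Y \<inter> Z)) (card Z) else 0 else 0)" for j k
  proof -
    have "(\<Sum>p\<le>card I. h j p k * (of_bool (card Y = j \<and> card Z = k) * of_bool (card (Y \<inter> Z) = p)))
      = (\<Sum>p\<le>card I. if card (Y \<inter> Z) = p then h j p k * of_bool (card Y = j \<and> card Z = k) else 0)"
      by (intro sum.cong) auto
    then show ?thesis using le by (simp add: sum.delta)
  qed
  then show "(\<Sum>j\<le>card I. \<Sum>k\<le>card I. \<Sum>p\<le>card I. h j p k *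
      (of_bool (card Y = j \<and> card Z = k) * of_bool (card (Y \<inter> Z) = p))) = h (card Y) (card (Y \<inter> Z)) (card Z)"
    using le by (simp add: sum.delta)
qed

section \<open>The endomorphism of a kernel\<close>

definition diffset :: "nat \<Rightarrow> vertex \<Rightarrow> vertex \<Rightarrow> nat set" where
  "diffset N \<kappa> x = {i \<in> {1..N}. x i \<noteq> \<kappa> i}"

lemma X_values: "x \<in> X N \<Longrightarrow> i \<in> {1..N} \<Longrightarrow> x i = 1 \<or> x i = -1"
  by (auto simp: X_def PiE_iff)

lemma diffset_bij:
  assumes "\<kappa> \<in> X N"
  shows "bij_betw (diffset N \<kappa>) (X N) (Pow {1..N})"
\<comment> \<open>The inverse flips the sign of \<kappa> on \<open>W\<close>. As the entries are 1
  or -1, exactly the coordinates in \<open>W\<close> change.\<close>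
proof (rule bij_betw_byWitness[where f' = "\<lambda>W. \<lambda>i\<in>{1..N}. if i \<in> W then - \<kappa> i else \<kappa> i"])
  show "\<forall>x\<in>X N. (\<lambda>i\<in>{1..N}. if i \<in> diffset N \<kappa> x then - \<kappa> i else \<kappa> i) = x"
  proof (intro ballI ext)
    fix x i assume x: "x \<in> X N"
    show "(\<lambda>i\<in>{1..N}. if i \<in> diffset N \<kappa> x then - \<kappa> i else \<kappa> i) i = x i"
    proof (cases "i \<in> {1..N}")
      case True
      then show ?thesis
        using X_values[OF x True] X_values[OF assms True] by (auto simp: diffset_def)
    next
      case False
      with x show ?thesis by (auto simp: X_def)
    qed
  qed
  show "\<forall>W\<in>Pow {1..N}. diffset N \<kappa> (\<lambda>i\<in>{1..N}. if i \<in> W then - \<kappa> i else \<kappa> i) = W"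
  proof
    fix W assume W: "W \<in> Pow {1..N}"
    have "- \<kappa> i \<noteq> \<kappa> i" if "i \<in> {1..N}" for i
      using X_values[OF assms that] by auto
    then have "diffset N \<kappa> (\<lambda>i\<in>{1..N}. if i \<in> W then - \<kappa> i else \<kappa> i) = {i \<in> {1..N}. i \<in> W}"
      unfolding diffset_def by (intro Collect_cong conj_cong refl) auto
    with W show "diffset N \<kappa> (\<lambda>i\<in>{1..N}. if i \<in> W then - \<kappa> i else \<kappa> i) = W"
      by auto
  qed
  show "diffset N \<kappa> ` X N \<subseteq> Pow {1..N}"
    by (auto simp: diffset_def)
  show "(\<lambda>W. \<lambda>i\<in>{1..N}. if i \<in> W then - \<kappa> i else \<kappa> i) ` Pow {1..N} \<subseteq> X N"
  proof -
    have "(if i \<in> W then - \<kappa> i else \<kappa> i) \<in> {1, -1}" if "i \<in> {1..N}" for i W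
      using X_values[OF assms that] by auto
    then show ?thesis
      unfolding X_def by (intro image_subsetI restrict_PiE_iff[THEN iffD2] ballI)
  qed
qed

lemma diffset_subset: "diffset N \<kappa> x \<subseteq> {1..N}"
  by (auto simp: diffset_def)

lemma finite_diffset [simp]: "finite (diffset N \<kappa> x)"
  by (simp add: diffset_def)

lemma diffset_eq_iff:
  assumes "\<kappa> \<in> X N" "x \<in> X N" "y \<in> X N"
  shows "diffset N \<kappa> x = diffset N \<kappa> y \<longleftrightarrow> x = y"
  using bij_betw_imp_inj_on[OF diffset_bij[OF assms(1)]] assms by (auto dest: inj_onD)

lemma sum_diffset:
  assumes "\<kappa> \<in> X N"
  shows "(\<Sum>x\<in>X N. h (diffset N \<kappa> x)) = (\<Sum>Y\<in>Pow {1..N}. h Y)"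
  by (rule sum.reindex_bij_betw[OF diffset_bij[OF assms]])

lemma sym_diff_diffset:
  assumes "\<kappa> \<in> X N" "x \<in> X N" "y \<in> X N"
  shows "sym_diff (diffset N \<kappa> x) (diffset N \<kappa> y) = {i \<in> {1..N}. x i \<noteq> y i}"
proof (rule set_eqI)
  fix i
  show "i \<in> sym_diff (diffset N \<kappa> x) (diffset N \<kappa> y) \<longleftrightarrow> i \<in> {i \<in> {1..N}. x i \<noteq> y i}"
  proof (cases "i \<in> {1..N}")
    case True
    \<comment> \<open>With only two values available, two entries that both differ from
      \<open>\<kappa> i\<close> are equal.\<close>
    from assms[THEN X_values, OF True] True show ?thesis by (auto simp: diffset_def)
  qed (auto simp: diffset_def)
qed

lemma edges_iff_sym_diff:
  assumes "\<kappa> \<in> X N" "x \<in> X N" "y \<in> X N"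
  shows "(x, y) \<in> edges N \<longleftrightarrow> card (sym_diff (diffset N \<kappa> x) (diffset N \<kappa> y)) = 1"
  unfolding sym_diff_diffset[OF assms] using assms by (simp add: edges_def)

text \<open>Resetting the differing coordinates to those of \<kappa> one at a time gives a walk of
  this length. Conversely, an edge removes at most one element from the difference set, so no walk
  is shorter.\<close>

lemma distance_eq_card_diffset:
  assumes \<kappa>: "\<kappa> \<in> X N" and x: "x \<in> X N"
  shows "distance N x \<kappa> = card (diffset N \<kappa> x)"
  unfolding distance_def
proof (rule Least_equality)
  show "(x, \<kappa>) \<in> edges N ^^ card (diffset N \<kappa> x)"
    using x
  proof (induction "card (diffset N \<kappa> x)" arbitrary: x)
    case 0
    from 0(1) have "diffset N \<kappa> x = diffset N \<kappa> \<kappa>" by (simp add: diffset_def)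
    then have "x = \<kappa>" using diffset_eq_iff[OF \<kappa> 0(2) \<kappa>] by blast
    then show ?case using 0(1)[symmetric] by simp
  next
    case (Suc n)
    then obtain i where i: "i \<in> diffset N \<kappa> x"
      by (metis card.empty ex_in_conv nat.distinct(1))
    define y where "y = x(i := \<kappa> i)"
    have y: "y \<in> X N"
      using Suc.prems i \<kappa> by (auto simp: y_def X_def PiE_iff diffset_def extensional_def)
    have "diffset N \<kappa> y = diffset N \<kappa> x - {i}"
      by (auto simp: y_def diffset_def)
    then have n: "n = card (diffset N \<kappa> y)"
      using Suc.hyps(2) i by simp
    have "{j \<in> {1..N}. x j \<noteq> y j} = {i}"
      using i by (auto simp: y_def diffset_def)
    then have "(x, y) \<in> edges N"
      using Suc.prems y by (simp add: edges_def)
    then show ?case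
      using Suc.hyps(1)[OF n y] unfolding n[symmetric] Suc.hyps(2)[symmetric]
      by (rule relpow_Suc_I2)
  qed
next
  fix n assume "(x, \<kappa>) \<in> edges N ^^ n"
  then show "card (diffset N \<kappa> x) \<le> n"
  proof (induction n arbitrary: x)
    case 0
    then show ?case by (simp add: diffset_def)
  next
    case (Suc n)
    then obtain y where y: "(x, y) \<in> edges N" "(y, \<kappa>) \<in> edges N ^^ n"
      by (meson relpow_Suc_D2)
    have "diffset N \<kappa> x \<subseteq> diffset N \<kappa> y \<union> {i \<in> {1..N}. x i \<noteq> y i}"
      by (auto simp: diffset_def)
    then have "card (diffset N \<kappa> x) \<le> card (diffset N \<kappa> y \<union> {i \<in> {1..N}. x i \<noteq> y i})"
      by (intro card_mono) simp_all
    also have "\<dots> \<le> card (diffset N \<kappa> y) + card {i \<in> {1..N}. x i \<noteq> y i}"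
      by (rule card_Un_le)
    also have "\<dots> \<le> Suc n"
      using y Suc.IH[OF y(2)] by (simp add: edges_def)
    finally show ?case .
  qed
qed

section \<open>Operators attached to kernels\<close>

definition kop :: "nat \<Rightarrow> vertex \<Rightarrow> (nat set \<Rightarrow> nat set \<Rightarrow> complex) \<Rightarrow> endo" where
  "kop N \<kappa> K = (\<lambda>v\<in>V N. lin_ext (\<lambda>z. \<Sum>y\<in>X N. K (diffset N \<kappa> y) (diffset N \<kappa> z) \<cdot> basis y) v)"

lemma lookup_sum_basis:
  assumes "finite S"
  shows "Poly_Mapping.lookup (\<Sum>y\<in>S. c y \<cdot> basis y) a = (if a \<in> S then c a else 0)"
proof -
  have "Poly_Mapping.lookup (\<Sum>y\<in>S. c y \<cdot> basis y) a = (\<Sum>y\<in>S. if a = y then c y else 0)"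
    unfolding lookup_sum by (intro sum.cong) (auto simp: lookup_single when_def)
  then show ?thesis using assms by (simp add: sum.delta)
qed

lemma lookup_lin_ext_V:
  "v \<in> V N \<Longrightarrow> Poly_Mapping.lookup (lin_ext \<phi> v) a
    = (\<Sum>z\<in>X N. Poly_Mapping.lookup v z * Poly_Mapping.lookup (\<phi> z) a)"
  by (rule lookup_lin_ext) (simp_all add: V_def)

lemma lookup_V_outside: "v \<in> V N \<Longrightarrow> a \<notin> X N \<Longrightarrow> Poly_Mapping.lookup v a = 0"
  by (auto simp: V_def in_keys_iff)

lemma lookup_kop:
  assumes "v \<in> V N"
  shows "Poly_Mapping.lookup (kop N \<kappa> K v) a =
    (if a \<in> X N then \<Sum>z\<in>X N. K (diffset N \<kappa> a) (diffset N \<kappa> z) * Poly_Mapping.lookup v z else 0)"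
  using assms by (simp add: kop_def lookup_lin_ext_V lookup_sum_basis mult.commute)

lemma kop_eqI:
  assumes "F \<in> extensional (V N)"
    and "\<And>v a. v \<in> V N \<Longrightarrow> a \<in> X N \<Longrightarrow> Poly_Mapping.lookup (F v) a
      = (\<Sum>z\<in>X N. K (diffset N \<kappa> a) (diffset N \<kappa> z) * Poly_Mapping.lookup v z)"
    and "\<And>v a. v \<in> V N \<Longrightarrow> a \<notin> X N \<Longrightarrow> Poly_Mapping.lookup (F v) a = 0"
  shows "kop N \<kappa> K = F"
proof (rule extensionalityI[OF _ assms(1)])
  show "kop N \<kappa> K \<in> extensional (V N)" by (simp add: kop_def)
  show "kop N \<kappa> K v = F v" if "v \<in> V N" for v
    using assms(2,3)[OF that] that by (intro poly_mapping_eqI) (simp add: lookup_kop)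
qed

lemma sum_diffset_eq:
  assumes "\<kappa> \<in> X N" "a \<in> X N"
  shows "(\<Sum>z\<in>X N. of_bool (diffset N \<kappa> a = diffset N \<kappa> z) * h z) = (h a :: complex)"
proof -
  have "(\<Sum>z\<in>X N. of_bool (diffset N \<kappa> a = diffset N \<kappa> z) * h z) = (\<Sum>z\<in>X N. if a = z then h z else 0)"
    using assms by (intro sum.cong) (auto simp: diffset_eq_iff)
  then show ?thesis using assms by simp
qed

text \<open>Rule induction matches each rule of \<open>kalg\<close> with a closure property of a
  subalgebra. Taking \<open>S\<close> arbitrary gives membership in the hull.\<close>

lemma kop_in_subalgebra:
  assumes \<kappa>: "\<kappa> \<in> X N" and S: "subalgebra N S" "A N \<in> S" "A_star N \<kappa> \<in> S"
    and K: "K \<in> kalg {1..N}"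
  shows "kop N \<kappa> K \<in> S"
  using K
proof (induction rule: kalg.induct)
  have id: "(\<lambda>v\<in>V N. v) \<in> S"
    and sc: "\<And>c F. F \<in> S \<Longrightarrow> (\<lambda>v\<in>V N. c \<cdot> F v) \<in> S"
    and pl: "\<And>F G. F \<in> S \<Longrightarrow> G \<in> S \<Longrightarrow> (\<lambda>v\<in>V N. F v + G v) \<in> S"
    and co: "\<And>F G. F \<in> S \<Longrightarrow> G \<in> S \<Longrightarrow> compose (V N) F G \<in> S"
    using S(1) by (auto simp: subalgebra_def)
  {
    case one
    have "kop N \<kappa> (\<lambda>Y Z. of_bool (Y = Z)) = (\<lambda>v\<in>V N. v)"
      by (rule kop_eqI) (simp_all add: sum_diffset_eq \<kappa> lookup_V_outside del: sum_of_bool_mult_eq)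
    with id show ?case by (simp only:)
  next
    case adj
    have nb: "Poly_Mapping.lookup (\<Sum>y | (x, y) \<in> edges N. basis y) a
        = (if (x, a) \<in> edges N then 1 else 0)" for x a
    proof -
      have "finite {y. (x, y) \<in> edges N}"
        by (rule finite_subset[of _ "X N"]) (auto simp: edges_def)
      from lookup_sum_basis[OF this, of "\<lambda>_. 1" a] show ?thesis by simp
    qed
    have "kop N \<kappa> (\<lambda>Y Z. of_bool (card (sym_diff Y Z) = 1)) = A N"
    proof (rule kop_eqI)
      fix v a assume v: "v \<in> V N" and a: "a \<in> X N"
      have "Poly_Mapping.lookup (A N v) a = (\<Sum>z\<in>X N. Poly_Mapping.lookup v z * (if (z, a) \<in> edges N then 1 else 0))"
        using v by (simp add: A_def lookup_lin_ext_V nb)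
      also have "\<dots> = (\<Sum>z\<in>X N. of_bool (card (sym_diff (diffset N \<kappa> a) (diffset N \<kappa> z)) = 1) * Poly_Mapping.lookup v z)"
        by (intro sum.cong refl) (simp add: edges_iff_sym_diff[OF \<kappa> _ a] Un_commute)
      finally show "Poly_Mapping.lookup (A N v) a
          = (\<Sum>z\<in>X N. of_bool (card (sym_diff (diffset N \<kappa> a) (diffset N \<kappa> z)) = 1) * Poly_Mapping.lookup v z)" .
    next
      fix v a assume v: "v \<in> V N" and "a \<notin> X N"
      then have "(z, a) \<notin> edges N" for z by (simp add: edges_def)
      with v show "Poly_Mapping.lookup (A N v) a = 0"
        by (simp add: A_def lookup_lin_ext_V nb)
    qed (simp add: A_def)
    with S(2) show ?case by simp
  next
    case card
    \<comment> \<open>This is half of \<open>N\<close> times the identity minus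
      \<open>A_star\<close>. The nested restrictions copy the closure properties literally, so these
      alone give \<open>?F \<in> S\<close>.\<close>
    let ?F = "\<lambda>v\<in>V N. (1/2) \<cdot> (\<lambda>v\<in>V N. (\<lambda>v\<in>V N. of_nat N \<cdot> (\<lambda>v\<in>V N. v) v) v
                + (\<lambda>v\<in>V N. (-1) \<cdot> A_star N \<kappa> v) v) v"
    have A_star: "Poly_Mapping.lookup (A_star N \<kappa> v) a
        = (of_nat N - 2 * of_nat (card (diffset N \<kappa> a))) * Poly_Mapping.lookup v a"
      if "v \<in> V N" for v a
    proof -
      have "Poly_Mapping.lookup (A_star N \<kappa> v) a
          = (\<Sum>z\<in>X N. if a = z then (of_nat N - 2 * of_nat (card (diffset N \<kappa> z))) * Poly_Mapping.lookup v z else 0)"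
        unfolding A_star_def using that
        by (subst restrict_apply', assumption, subst lookup_lin_ext_V, assumption, intro sum.cong refl)
          (simp add: lookup_single when_def distance_eq_card_diffset[OF \<kappa>])
      then show ?thesis using that by (simp add: sum.delta lookup_V_outside)
    qed
    have "kop N \<kappa> (\<lambda>Y Z. of_bool (Y = Z) * of_nat (card Y)) = ?F"
    proof (rule kop_eqI)
      fix v a assume v: "v \<in> V N" and a: "a \<in> X N"
      have "(\<Sum>z\<in>X N. of_bool (diffset N \<kappa> a = diffset N \<kappa> z) * of_nat (card (diffset N \<kappa> a)) * Poly_Mapping.lookup v z)
          = of_nat (card (diffset N \<kappa> a)) * Poly_Mapping.lookup v a"
        using sum_diffset_eq[OF \<kappa> a] by (simp only: mult.assoc)
      with v show "Poly_Mapping.lookup (?F v) a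
          = (\<Sum>z\<in>X N. of_bool (diffset N \<kappa> a = diffset N \<kappa> z) * of_nat (card (diffset N \<kappa> a)) * Poly_Mapping.lookup v z)"
        by (simp add: lookup_add A_star algebra_simps)
    qed (simp_all add: lookup_add A_star lookup_V_outside)
    moreover have "?F \<in> S"
      by (intro sc pl id S)
    ultimately show ?case by (simp only:)
  next
    case (scale K c)
    have "kop N \<kappa> (\<lambda>Y Z. c * K Y Z) = (\<lambda>v\<in>V N. c \<cdot> kop N \<kappa> K v)"
      by (rule kop_eqI) (simp_all add: lookup_kop sum_distrib_left mult.assoc)
    with sc[OF scale.IH] show ?case by (simp only:)
  next
    case (add K L)
    have "kop N \<kappa> (\<lambda>Y Z. K Y Z + L Y Z) = (\<lambda>v\<in>V N. kop N \<kappa> K v + kop N \<kappa> L v)"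
      by (rule kop_eqI) (simp_all add: lookup_add lookup_kop sum.distrib distrib_right)
    with pl[OF add.IH] show ?case by (simp only:)
  next
    case (mult K L)
    \<comment> \<open>The inner operator must land in \<open>V N\<close> before the entry formula
      applies to the outer one.\<close>
    have V: "kop N \<kappa> L v \<in> V N" if "v \<in> V N" for v
      using that by (auto simp: V_def in_keys_iff lookup_kop[unfolded V_def] split: if_splits)
    \<comment> \<open>Rows index the image and columns the argument, so composition is the kernel
      product once the sum over subsets is read as a sum over vertices.\<close>
    have "kop N \<kappa> (\<lambda>Y Z. \<Sum>W\<in>Pow {1..N}. K Y W * L W Z) = compose (V N) (kop N \<kappa> K) (kop N \<kappa> L)"
    proof (rule kop_eqI)
      fix v a assume v: "v \<in> V N" and a: "a \<in> X N"
      have "(\<Sum>z\<in>X N. (\<Sum>W\<in>Pow {1..N}. K (diffset N \<kappa> a) W * L W (diffset N \<kappa> z)) * Poly_Mapping.lookup v z)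
          = (\<Sum>z\<in>X N. (\<Sum>w\<in>X N. K (diffset N \<kappa> a) (diffset N \<kappa> w) * L (diffset N \<kappa> w) (diffset N \<kappa> z))
              * Poly_Mapping.lookup v z)"
        by (subst sum_diffset[OF \<kappa>, symmetric]) simp
      also have "\<dots> = (\<Sum>w\<in>X N. \<Sum>z\<in>X N. K (diffset N \<kappa> a) (diffset N \<kappa> w) * L (diffset N \<kappa> w) (diffset N \<kappa> z)
              * Poly_Mapping.lookup v z)"
        unfolding sum_distrib_right by (rule sum.swap)
      also have "\<dots> = Poly_Mapping.lookup (compose (V N) (kop N \<kappa> K) (kop N \<kappa> L) v) a"
        using v a V by (simp add: compose_def lookup_kop sum_distrib_left mult.assoc)
      finally show "Poly_Mapping.lookup (compose (V N) (kop N \<kappa> K) (kop N \<kappa> L) v) a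
          = (\<Sum>z\<in>X N. (\<Sum>W\<in>Pow {1..N}. K (diffset N \<kappa> a) W * L W (diffset N \<kappa> z)) * Poly_Mapping.lookup v z)"
        by simp
    qed (simp_all add: compose_def lookup_kop V)
    with co[OF mult.IH] show ?case by (simp only:)
  next
    case (cong K L)
    have "kop N \<kappa> L = kop N \<kappa> K"
      unfolding kop_def using cong.hyps(2)[OF diffset_subset diffset_subset] by simp
    with cong.IH show ?case by (simp only:)
  }
qed

lemma kop_in_T:
  assumes "\<kappa> \<in> X N" "K \<in> kalg {1..N}"
  shows "kop N \<kappa> K \<in> T N \<kappa>"
  unfolding T_def hull_def using kop_in_subalgebra[OF assms(1) _ _ _ assms(2)] by auto

lemma End_form_kop:
  assumes "\<kappa> \<in> X N"
  shows "End_form N (kop N \<kappa> K) (kop N \<kappa> L) = (\<Sum>Y\<in>Pow {1..N}. \<Sum>Z\<in>Pow {1..N}. K Y Z * cnj (L Y Z))"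
proof -
  have entry: "Poly_Mapping.lookup (kop N \<kappa> K (basis y)) x = K (diffset N \<kappa> x) (diffset N \<kappa> y)"
    if "x \<in> X N" "y \<in> X N" for K x y
    using that by (simp add: kop_def lookup_sum_basis)
  have "End_form N (kop N \<kappa> K) (kop N \<kappa> L) = (\<Sum>x\<in>X N. \<Sum>y\<in>X N.
      K (diffset N \<kappa> x) (diffset N \<kappa> y) * cnj (L (diffset N \<kappa> x) (diffset N \<kappa> y)))"
    unfolding End_form_def by (intro sum.cong refl) (simp add: entry)
  also have "\<dots> = (\<Sum>x\<in>X N. \<Sum>Z\<in>Pow {1..N}. K (diffset N \<kappa> x) Z * cnj (L (diffset N \<kappa> x) Z))"
    by (intro sum.cong refl sum_diffset[OF assms])
  also have "\<dots> = (\<Sum>Y\<in>Pow {1..N}. \<Sum>Z\<in>Pow {1..N}. K Y Z * cnj (L Y Z))"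
    by (rule sum_diffset[OF assms])
  finally show ?thesis .
qed

section \<open>Profiles\<close>

text \<open>The sizes of the four regions cut out by \<open>Y\<close> and \<open>Z\<close>, in the
  order outside both, in both, only in \<open>Y\<close>, only in \<open>Z\<close>. Only three sizes
  enter, to fit \<open>kalg_card_fun\<close>; adding the intersection first avoids truncated
  subtraction.\<close>

definition set_profile :: "nat \<Rightarrow> nat set \<Rightarrow> nat set \<Rightarrow> expo" where
  "set_profile N Y Z = (N + card (Y \<inter> Z) - card Y - card Z, card (Y \<inter> Z),
     card Y - card (Y \<inter> Z), card Z - card (Y \<inter> Z))"

text \<open>The conditions are arranged for counting: first \<open>Y\<close>, then the part of
  \<open>Z\<close> inside \<open>Y\<close>, then the part outside.\<close>

lemma set_profile_eq_iff:
  assumes "finite I" "Y \<subseteq> I" "Z \<subseteq> I" "r + s + t + u = card I"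
  shows "set_profile (card I) Y Z = (r, s, t, u)
    \<longleftrightarrow> card Y = s + t \<and> card (Y \<inter> Z) = s \<and> card (Z - Y) = u"
proof -
  have fin: "finite Y" "finite Z" using assms finite_subset by auto
  have "card Y = card (Y \<inter> Z) + card (Y - Z)" "card Z = card (Y \<inter> Z) + card (Z - Y)"
    using card_Int_Diff[OF fin(1), of Z] card_Int_Diff[OF fin(2), of Y] by (simp_all only: Int_commute[of Z Y])
  moreover have "card Y + card Z = card (Y \<union> Z) + card (Y \<inter> Z)"
    by (rule card_Un_Int[OF fin])
  moreover have "card (Y \<union> Z) \<le> card I"
    using assms by (intro card_mono) auto
  ultimately show ?thesis
    using assms(4) unfolding set_profile_def prod.inject by linarith
qed

lemma profile_eq_set_profile:
  assumes "\<kappa> \<in> X N" "y \<in> X N" "z \<in> X N"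
  shows "profile N \<kappa> y z = set_profile N (diffset N \<kappa> y) (diffset N \<kappa> z)"
proof -
  let ?Y = "diffset N \<kappa> y" and ?Z = "diffset N \<kappa> z"
  have "{i \<in> {1..N}. \<kappa> i = y i \<and> y i = z i} = {1..N} - (?Y \<union> ?Z)"
    "{i \<in> {1..N}. y i \<noteq> z i \<and> z i = \<kappa> i} = ?Y - ?Z"
    "{i \<in> {1..N}. z i \<noteq> \<kappa> i \<and> \<kappa> i = y i} = ?Z - ?Y"
    by (auto simp: diffset_def)
  \<comment> \<open>Here again two values per coordinate matter: \<open>y i\<close> and
    \<open>z i\<close> agree as soon as both differ from \<open>\<kappa> i\<close>.\<close>
  moreover have "{i \<in> {1..N}. \<kappa> i \<noteq> y i \<and> y i = z i} = ?Y \<inter> ?Z"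
  proof (rule set_eqI)
    fix i
    show "i \<in> {i \<in> {1..N}. \<kappa> i \<noteq> y i \<and> y i = z i} \<longleftrightarrow> i \<in> ?Y \<inter> ?Z"
    proof (cases "i \<in> {1..N}")
      case True
      from assms[THEN X_values, OF True] True show ?thesis by (auto simp: diffset_def)
    qed (auto simp: diffset_def)
  qed
  moreover have "card ({1..N} - (?Y \<union> ?Z)) = N - card (?Y \<union> ?Z)"
    using diffset_subset by (subst card_Diff_subset) auto
  moreover have "card ?Y + card ?Z = card (?Y \<union> ?Z) + card (?Y \<inter> ?Z)"
    by (rule card_Un_Int) simp_all
  ultimately show ?thesis
    by (simp add: profile_def set_profile_def card_Diff_subset_Int Int_commute)
qed

section \<open>Counting the pairs of a given profile\<close>

lemma finite_expos: "finite (expos N)"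
  by (rule finite_subset[of _ "{..N} \<times> {..N} \<times> {..N} \<times> {..N}"]) (auto simp: expos_def)

lemma set_profile_in_expos:
  assumes "Y \<subseteq> {1..N}" "Z \<subseteq> {1..N}"
  shows "set_profile N Y Z \<in> expos N"
proof -
  have fin: "finite Y" "finite Z" using assms finite_subset by auto
  have "card (Y \<union> Z) \<le> card {1..N}"
    using assms by (intro card_mono) auto
  moreover have "card Y + card Z = card (Y \<union> Z) + card (Y \<inter> Z)"
    by (rule card_Un_Int[OF fin])
  moreover have "card (Y \<inter> Z) \<le> card Y" "card (Y \<inter> Z) \<le> card Z"
    using fin by (auto intro: card_mono)
  ultimately show ?thesis by (simp add: set_profile_def expos_def)
qed

text \<open>Choosing \<open>s + t\<close> elements for \<open>Y\<close>, then \<open>s\<close>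
  elements of \<open>Z\<close> inside \<open>Y\<close> and \<open>u\<close> among the
  \<open>r + u\<close> outside, gives three binomials whose product is the multinomial
  coefficient.\<close>

lemma card_set_profile:
  assumes "m \<in> expos N"
  shows "card {(Y, Z) \<in> Pow {1..N} \<times> Pow {1..N}. set_profile N Y Z = m} * expo_fact m = fact N"
proof -
  obtain r s t u where m: "m = (r, s, t, u)" by (cases m)
  with assms have N: "r + s + t + u = N" by (simp add: expos_def)
  define I where "I = {1..N}"
  have I: "finite I" "card I = N" by (simp_all add: I_def)
  let ?J = "{Y. Y \<subseteq> I \<and> card Y = s + t}"
  let ?Q = "\<lambda>Y. {Z. Z \<subseteq> I \<and> card (Y \<inter> Z) = s \<and> card (Z - Y) = u}"
  have inner: "card (?Q Y) = ((s + t) choose s) * ((r + u) choose u)" if Y: "Y \<in> ?J" for Y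
  proof -
    have fin: "finite Y" "finite (I - Y)" using Y I by (auto intro: finite_subset)
    \<comment> \<open>\<open>Y\<close> splits \<open>Z\<close> into two parts that can be chosen
      independently.\<close>
    have "bij_betw (\<lambda>Z. (Y \<inter> Z, Z - Y)) (?Q Y) ({C. C \<subseteq> Y \<and> card C = s} \<times> {D. D \<subseteq> I - Y \<and> card D = u})"
    proof (rule bij_betw_byWitness[where f' = "\<lambda>(C, D). C \<union> D"])
      show "(\<lambda>(C, D). C \<union> D) ` ({C. C \<subseteq> Y \<and> card C = s} \<times> {D. D \<subseteq> I - Y \<and> card D = u}) \<subseteq> ?Q Y"
      proof clarsimp
        fix C D assume *: "C \<subseteq> Y" "D \<subseteq> I - Y" "s = card C" "u = card D"
        then have "Y \<inter> (C \<union> D) = C" "C \<union> D - Y = D" by auto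
        with * Y show "C \<subseteq> I \<and> D \<subseteq> I \<and> card (Y \<inter> (C \<union> D)) = card C \<and> card (C \<union> D - Y) = card D"
          by auto
      qed
    qed auto
    then have "card (?Q Y) = (card Y choose s) * (card (I - Y) choose u)"
      using fin by (simp add: bij_betw_same_card n_subsets card_cartesian_product)
    moreover have "card (I - Y) = r + u"
      using Y fin I N by (simp add: card_Diff_subset)
    ultimately show ?thesis using Y by simp
  qed
  have "{(Y, Z) \<in> Pow {1..N} \<times> Pow {1..N}. set_profile N Y Z = m} = (SIGMA Y:?J. ?Q Y)"
    using set_profile_eq_iff[OF I(1), of _ _ r s t u] I N by (auto simp: m I_def)
  then have card: "card {(Y, Z) \<in> Pow {1..N} \<times> Pow {1..N}. set_profile N Y Z = m}
      = (N choose (s + t)) * (((s + t) choose s) * ((r + u) choose u))"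
    using I inner by (simp add: n_subsets)
  have "fact N = fact (s + t) * fact (r + u) * (N choose (s + t))"
    using binomial_fact_lemma[of "s + t" N] N by (simp add: algebra_simps flip: N)
  moreover have "fact (s + t) = fact s * fact t * ((s + t) choose s)"
    using binomial_fact_lemma[of s "s + t"] by simp
  moreover have "fact (r + u) = fact r * fact u * ((r + u) choose u)"
    using binomial_fact_lemma[of u "r + u"] by (simp add: mult_ac)
  ultimately show ?thesis
    unfolding card by (simp add: m expo_fact_def mult_ac)
qed

section \<open>The map from polynomials to kernels\<close>

text \<open>The denominator is what remains of the constants in \<open>ddag\<close>,
  \<open>B_tilde\<close> and \<open>\<epsilon>\<close>; see \<open>\<theta>_scalar\<close>.\<close>

definition poly_kernel :: "nat \<Rightarrow> poly4 \<Rightarrow> nat set \<Rightarrow> nat set \<Rightarrow> complex" where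
  "poly_kernel N f Y Z = Poly_Mapping.lookup f (set_profile N Y Z) * of_nat (expo_fact (set_profile N Y Z))
     / complex_of_real (sqrt (fact N))"

lemma poly_kernel_in_kalg: "poly_kernel N f \<in> kalg {1..N}"
  using kalg_card_fun[of "{1..N}" "\<lambda>j p k. Poly_Mapping.lookup f (N + p - j - k, p, j - p, k - p)
      * of_nat (expo_fact (N + p - j - k, p, j - p, k - p)) / complex_of_real (sqrt (fact N))"]
  by (simp add: poly_kernel_def[abs_def] set_profile_def)

section \<open>Matrix entries of \<theta>\<close>

lemma lookup_B: "Poly_Mapping.lookup (B N m) (x, y, z)
    = of_bool (x \<in> X N \<and> y \<in> X N \<and> z \<in> X N \<and> profile N x y z = m)"
proof -
  let ?S = "{(x, y, z) \<in> X N \<times> X N \<times> X N. profile N x y z = m}"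
  have "finite ?S"
    by (rule finite_subset[of _ "X N \<times> X N \<times> X N"]) auto
  from lookup_sum_basis[OF this, of "\<lambda>_. 1" "(x, y, z)"] show ?thesis
    by (simp add: B_def case_prod_beta)
qed

text \<open>A triple has just one profile, so a single monomial of \<open>f\<close> contributes to
  its coefficient.\<close>

lemma lookup_ddag: "Poly_Mapping.lookup (ddag N f) (x, y, z) =
    (if x \<in> X N \<and> y \<in> X N \<and> z \<in> X N then
      complex_of_real (sqrt (fact N * 2 ^ N)) / (fact N * 2 ^ N)
        * (Poly_Mapping.lookup f (profile N x y z) * of_nat (expo_fact (profile N x y z))) else 0)"
proof -
  let ?c = "complex_of_real (sqrt (fact N * 2 ^ N))"
  let ?h = "\<lambda>m. ?c / (fact N * 2 ^ N) * (Poly_Mapping.lookup f m * of_nat (expo_fact m))"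
  have "Poly_Mapping.lookup (ddag N f) (x, y, z) = (\<Sum>m\<in>Poly_Mapping.keys f.
      if m = profile N x y z then if x \<in> X N \<and> y \<in> X N \<and> z \<in> X N then ?h m else 0 else 0)"
    unfolding ddag_def B_tilde_def
    by (subst lookup_lin_ext[OF finite_keys order_refl], intro sum.cong refl) (simp add: lookup_B)
  \<comment> \<open>If the profile is not a key of \<open>f\<close>, its coefficient is 0 and both
    sides vanish.\<close>
  then show ?thesis by (simp add: sum.delta in_keys_iff)
qed

lemma lookup_\<epsilon>_basis:
  assumes "v \<in> V N"
  shows "Poly_Mapping.lookup (\<epsilon>_basis N \<kappa> (x, y, z) v) a =
    (if x = \<kappa> \<and> a = y then complex_of_real (2 powr (real N / 2)) * Poly_Mapping.lookup v z else 0)"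
proof -
  have "Poly_Mapping.lookup (e N y z v) a
      = (\<Sum>w\<in>X N. if w = z then if a = y then Poly_Mapping.lookup v w else 0 else 0)"
    unfolding e_def using assms
    by (subst restrict_apply', assumption, subst lookup_lin_ext_V, assumption, intro sum.cong refl)
      (auto simp: lookup_single when_def)
  then have "Poly_Mapping.lookup (e N y z v) a = (if a = y then Poly_Mapping.lookup v z else 0)"
    using assms by (auto simp: sum.delta lookup_V_outside)
  with assms show ?thesis by (cases "a = y") (simp_all add: \<epsilon>_basis_def)
qed

lemma \<theta>_scalar:
  "complex_of_real (sqrt (fact N * 2 ^ N)) / (fact N * 2 ^ N) * complex_of_real (2 powr (real N / 2))
    = 1 / complex_of_real (sqrt (fact N))"
proof -
  \<comment> \<open>As \<open>2 powr (real N / 2)\<close> is \<open>q\<close>, the claim becomes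
    \<open>p * q / (p * p * (q * q)) * q = 1 / p\<close>.\<close>
  define p q where "p = sqrt (fact N :: real)" and "q = sqrt (2 ^ N :: real)"
  have pq: "p > 0" "q > 0" "fact N = p * p" "2 ^ N = q * q"
    by (simp_all add: p_def q_def)
  have sqrt: "sqrt (fact N * 2 ^ N) = p * q"
    by (simp add: p_def q_def real_sqrt_mult)
  have powr: "2 powr (real N / 2) = q"
    by (simp add: q_def powr_half_sqrt[symmetric] powr_powr flip: powr_realpow)
  have "sqrt (fact N * 2 ^ N) / (fact N * 2 ^ N) * 2 powr (real N / 2) = p * q / (p * p * (q * q)) * q"
    unfolding sqrt powr unfolding pq(3,4) ..
  also have "\<dots> = 1 / sqrt (fact N)"
    unfolding p_def[symmetric] using pq(1,2) by (simp add: field_simps)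
  finally have "complex_of_real (sqrt (fact N * 2 ^ N) / (fact N * 2 ^ N) * 2 powr (real N / 2))
      = complex_of_real (1 / sqrt (fact N))" by simp
  then show ?thesis by simp
qed

text \<open>\<open>\<epsilon>\<close> discards the triples that do not start with \<kappa>, and the
  triple \<open>(\<kappa>, a, z)\<close> feeds exactly the entry in row \<open>a\<close> and column
  \<open>z\<close>.\<close>

lemma \<theta>_eq_kop:
  assumes \<kappa>: "\<kappa> \<in> X N"
  shows "\<theta> N \<kappa> f = kop N \<kappa> (poly_kernel N f)"
proof (rule kop_eqI[symmetric])
  fix v a assume v: "v \<in> V N"
  let ?c = "complex_of_real (2 powr (real N / 2))"
  have keys: "Poly_Mapping.keys (ddag N f) \<subseteq> X N \<times> X N \<times> X N"
    by (auto simp: in_keys_iff lookup_ddag split: if_splits)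
  have "Poly_Mapping.lookup (\<theta> N \<kappa> f v) a = (\<Sum>b\<in>X N \<times> X N \<times> X N.
      Poly_Mapping.lookup (ddag N f) b * Poly_Mapping.lookup (\<epsilon>_basis N \<kappa> b v) a)"
    using v unfolding \<theta>_def \<epsilon>_def by (simp add: lookup_lin_ext[OF _ keys])
  also have "\<dots> = (\<Sum>x\<in>X N. \<Sum>y\<in>X N. \<Sum>z\<in>X N.
      Poly_Mapping.lookup (ddag N f) (x, y, z) * Poly_Mapping.lookup (\<epsilon>_basis N \<kappa> (x, y, z) v) a)"
    by (simp add: sum.cartesian_product case_prod_beta)
  also have "\<dots> = (\<Sum>x\<in>X N. \<Sum>y\<in>X N. if a = y then if x = \<kappa> then \<Sum>z\<in>X N.
      Poly_Mapping.lookup (ddag N f) (x, y, z) * (?c * Poly_Mapping.lookup v z) else 0 else 0)"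
  proof (intro sum.cong refl)
    fix x y
    show "(\<Sum>z\<in>X N. Poly_Mapping.lookup (ddag N f) (x, y, z) * Poly_Mapping.lookup (\<epsilon>_basis N \<kappa> (x, y, z) v) a)
        = (if a = y then if x = \<kappa> then \<Sum>z\<in>X N.
            Poly_Mapping.lookup (ddag N f) (x, y, z) * (?c * Poly_Mapping.lookup v z) else 0 else 0)"
      using v by (cases "a = y"; cases "x = \<kappa>") (simp_all add: lookup_\<epsilon>_basis)
  qed
  also have "\<dots> = (if a \<in> X N then \<Sum>z\<in>X N.
      Poly_Mapping.lookup (ddag N f) (\<kappa>, a, z) * (?c * Poly_Mapping.lookup v z) else 0)"
    using \<kappa> by (cases "a \<in> X N") (simp_all add: sum.delta)
  finally have eq: "Poly_Mapping.lookup (\<theta> N \<kappa> f v) a = \<dots>" .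
  show "a \<notin> X N \<Longrightarrow> Poly_Mapping.lookup (\<theta> N \<kappa> f v) a = 0"
    using eq by simp
  assume a: "a \<in> X N"
  have "Poly_Mapping.lookup (ddag N f) (\<kappa>, a, z) * (?c * Poly_Mapping.lookup v z)
      = poly_kernel N f (diffset N \<kappa> a) (diffset N \<kappa> z) * Poly_Mapping.lookup v z"
    if "z \<in> X N" for z
  proof -
    let ?q = "Poly_Mapping.lookup f (profile N \<kappa> a z) * of_nat (expo_fact (profile N \<kappa> a z))"
    have "Poly_Mapping.lookup (ddag N f) (\<kappa>, a, z) * ?c
        = ?q * (complex_of_real (sqrt (fact N * 2 ^ N)) / (fact N * 2 ^ N) * ?c)"
      using \<kappa> a that by (simp add: lookup_ddag)
    also have "\<dots> = poly_kernel N f (diffset N \<kappa> a) (diffset N \<kappa> z)"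
      unfolding \<theta>_scalar using \<kappa> a that by (simp add: poly_kernel_def profile_eq_set_profile)
    finally show ?thesis by (simp only: mult.assoc[symmetric])
  qed
  with eq a show "Poly_Mapping.lookup (\<theta> N \<kappa> f v) a
      = (\<Sum>z\<in>X N. poly_kernel N f (diffset N \<kappa> a) (diffset N \<kappa> z) * Poly_Mapping.lookup v z)"
    by simp
qed (simp add: \<theta>_def \<epsilon>_def)

section \<open>Comparison of the two forms\<close>

lemma sum_poly_kernel:
  assumes "f \<in> P N"
  shows "(\<Sum>Y\<in>Pow {1..N}. \<Sum>Z\<in>Pow {1..N}. poly_kernel N f Y Z * cnj (poly_kernel N g Y Z)) = P_form f g"
proof -
  let ?S = "Pow {1..N} \<times> Pow {1..N}"
  let ?h = "\<lambda>m. Poly_Mapping.lookup f m * cnj (Poly_Mapping.lookup g m) * of_nat (expo_fact m)"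
  let ?p = "\<lambda>(Y, Z). set_profile N Y Z"
  have sq: "complex_of_real (sqrt (fact N)) * complex_of_real (sqrt (fact N)) = fact N"
    by (simp flip: of_real_mult)
  have "(\<Sum>Y\<in>Pow {1..N}. \<Sum>Z\<in>Pow {1..N}. poly_kernel N f Y Z * cnj (poly_kernel N g Y Z))
      = (\<Sum>b\<in>?S. ?h (?p b) * of_nat (expo_fact (?p b)) / fact N)"
    unfolding sum.cartesian_product by (intro sum.cong refl) (auto simp: poly_kernel_def sq)
  \<comment> \<open>Grouped by profile \<open>m\<close>, the summand is constantly
    \<open>?h m * expo_fact m / fact N\<close>, which the size of the group turns into
    \<open>?h m\<close>.\<close>
  also have "\<dots> = (\<Sum>m\<in>expos N. \<Sum>b | b \<in> ?S \<and> ?p b = m. ?h (?p b) * of_nat (expo_fact (?p b)) / fact N)"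
    by (rule sum.group[symmetric]) (auto simp: finite_expos simp del: One_nat_def intro!: set_profile_in_expos)
  also have "\<dots> = (\<Sum>m\<in>expos N. ?h m)"
  proof (rule sum.cong[OF refl])
    fix m assume m: "m \<in> expos N"
    have set: "{b. b \<in> ?S \<and> ?p b = m} = {(Y, Z) \<in> ?S. set_profile N Y Z = m}" by auto
    have "(\<Sum>b | b \<in> ?S \<and> ?p b = m. ?h (?p b) * of_nat (expo_fact (?p b)) / fact N)
        = of_nat (card {b. b \<in> ?S \<and> ?p b = m}) * (?h m * of_nat (expo_fact m) / fact N)"
      by (subst sum_constant[symmetric], rule sum.cong) auto
    also have "\<dots> = ?h m * of_nat (card {b. b \<in> ?S \<and> ?p b = m} * expo_fact m) / fact N"
      by simp
    also have "\<dots> = ?h m"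
      unfolding set card_set_profile[OF m] by simp
    finally show "(\<Sum>b | b \<in> ?S \<and> ?p b = m. ?h (?p b) * of_nat (expo_fact (?p b)) / fact N) = ?h m" .
  qed
  \<comment> \<open>All keys of \<open>f\<close> lie in \<open>expos N\<close> because
    \<open>f \<in> P N\<close>; the other exponents contribute 0.\<close>
  also have "\<dots> = P_form f g"
    unfolding P_form_def using assms
    by (intro sum.mono_neutral_right finite_expos) (auto simp: P_def in_keys_iff)
  finally show ?thesis .
qed

theorem theorem18p22:
  fixes N :: nat and \<kappa> :: vertex
  assumes "\<kappa> \<in> X N"
  shows "\<forall>f\<in>P N. \<forall>g\<in>P N. P_form f g = T_form N \<kappa> (\<theta> N \<kappa> f) (\<theta> N \<kappa> g)"
proof (intro ballI)
  fix f g assume f: "f \<in> P N"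
  \<comment> \<open>\<open>T_form\<close> is a restricted function, so membership in T has to be
    known before its value can be unfolded.\<close>
  have "\<theta> N \<kappa> h \<in> T N \<kappa>" for h
    unfolding \<theta>_eq_kop[OF assms] by (rule kop_in_T[OF assms poly_kernel_in_kalg])
  then have "T_form N \<kappa> (\<theta> N \<kappa> f) (\<theta> N \<kappa> g) = End_form N (\<theta> N \<kappa> f) (\<theta> N \<kappa> g)"
    by (simp add: T_form_def)
  also have "\<dots> = P_form f g"
    unfolding \<theta>_eq_kop[OF assms] End_form_kop[OF assms] by (rule sum_poly_kernel[OF f])
  finally show "P_form f g = T_form N \<kappa> (\<theta> N \<kappa> f) (\<theta> N \<kappa> g)" ..
qed

end
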